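(* Let $\mathfrak{S}$ be the nonself-adjoint $2$-graph algebra generated by an isometric representation $(S,T)$ of a single vertex $2$-graph $\mathbb{F}_\theta^+$. If there are $k,l>0$ such that the free semigroup algebra $\mathfrak{S}_{k,l}$ is self-adjoint, then $\mathfrak{S}$ is self-adjoint.
   Context: Single vertex $2$-graph: for positive integers $m,n$ (with $m>1$ or $n>1$) and a permutation $\theta$ of $\{1,\ldots,m\}\times\{1,\ldots,n\}$, $\mathbb{F}_\theta^+$ is the unital cancellative semigroup generated by $e_1,\ldots,e_m,f_1,\ldots,f_n$, where the $e_i$ generate a copy of the free semigroup $\mathbb{F}_m^+$, the $f_j$ generate a copy of $\mathbb{F}_n^+$, and $e_if_j=f_{j'}e_{i'}$ whenever $\theta(i,j)=(i',j')$. Every $w\in\mathbb{F}_\theta^+$ is uniquely $w=e_uf_v$; its degree is $d(w)=(|u|,|v|)$. An isometric representation $(S,T)$ of $\mathbb{F}_\theta^+$ on a Hilbert space $\mathcal{H}$ consists of $S=[S_1,\ldots,S_m]$ and $T=[T_1,\ldots,T_n]$ with $S_i^*S_j=\delta_{i,j}I$, $T_k^*T_l=\delta_{k,l}I$, and $S_iT_j=T_{j'}S_{i'}$ whenever $\theta(i,j)=(i',j')$. For $w=e_uf_v$, $(ST)_w=S_uT_v$. The nonself-adjoint $2$-graph algebra $\mathfrak{S}$ generated by $(S,T)$ is the unital WOT-closed algebra generated by all $S_i,T_j$. $\mathfrak{S}_{k,l}$ is the unital WOT-closed algebra generated by $\{(ST)_w:d(w)=(k,l)\}$, which is a family of isometries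 with pairwise orthogonal ranges. *)

theory Defs
  imports "HOL-Analysis.Analysis" "HOL-Algebra.Group" "HOL-Combinatorics.Permutations"
begin

section \<open>Complex Hilbert spaces and bounded operators\<close>

text \<open>The inner product is linear in its first argument. The class extends \<^class>\<open>banach\<close>, so
  norm, topology and completeness are those of the library, tied to the inner product by
  \<open>norm_eq_sqrt_cinner\<close>.\<close>

class complex_hilbert = banach +
  fixes scaleC :: "complex \<Rightarrow> 'a \<Rightarrow> 'a"  (infixr "*\<^sub>C" 75)
    and cinner :: "'a \<Rightarrow> 'a \<Rightarrow> complex"
  assumes scaleC_add_right: "c *\<^sub>C (x + y) = c *\<^sub>C x + c *\<^sub>C y"
    and scaleC_add_left: "(c + d) *\<^sub>C x = c *\<^sub>C x + d *\<^sub>C x"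
    and scaleC_scaleC: "c *\<^sub>C d *\<^sub>C x = (c * d) *\<^sub>C x"
    and scaleC_one: "1 *\<^sub>C x = x"
    and scaleR_scaleC: "scaleR r x = complex_of_real r *\<^sub>C x"
    and cinner_commute: "cinner x y = cnj (cinner y x)"
    and cinner_add_left: "cinner (x + y) z = cinner x z + cinner y z"
    and cinner_scaleC_left: "cinner (c *\<^sub>C x) y = c * cinner x y"
    and cinner_self_real: "cinner x x \<in> \<real>"
    and cinner_self_ge_zero: "0 \<le> Re (cinner x x)"
    and cinner_eq_zero_iff: "cinner x x = 0 \<longleftrightarrow> x = 0"
    and norm_eq_sqrt_cinner: "norm x = sqrt (Re (cinner x x))"

definition bounded_ops :: "('a::complex_hilbert \<Rightarrow> 'a) set" where
  "bounded_ops = {A. bounded_linear A \<and> (\<forall>c x. A (c *\<^sub>C x) = c *\<^sub>C A x)}"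

text \<open>For a bounded operator the adjoint exists (Riesz) and is unique, so the description is
  proper there.\<close>

definition cadjoint :: "('a::complex_hilbert \<Rightarrow> 'a) \<Rightarrow> 'a \<Rightarrow> 'a" where
  "cadjoint A = (THE B. \<forall>x y. cinner (A x) y = cinner x (B y))"

text \<open>The weak operator topology: the coarsest topology on the bounded operators making every
  matrix coefficient continuous.\<close>

definition wot :: "('a::complex_hilbert \<Rightarrow> 'a) topology" where
  "wot = topology_generated_by
     {{A \<in> bounded_ops. cinner (A x) y \<in> U} | x y U. open U}"

definition unital_wot_closed_algebra :: "('a::complex_hilbert \<Rightarrow> 'a) set \<Rightarrow> bool" where
  "unital_wot_closed_algebra \<AA> \<longleftrightarrow>
     \<AA> \<subseteq> bounded_ops \<and> id \<in> \<AA> \<and>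
     (\<forall>A\<in>\<AA>. \<forall>B\<in>\<AA>. (\<lambda>x. A x + B x) \<in> \<AA>) \<and>
     (\<forall>c. \<forall>A\<in>\<AA>. (\<lambda>x. c *\<^sub>C A x) \<in> \<AA>) \<and>
     (\<forall>A\<in>\<AA>. \<forall>B\<in>\<AA>. A \<circ> B \<in> \<AA>) \<and>
     closedin wot \<AA>"

definition self_adjoint :: "('a::complex_hilbert \<Rightarrow> 'a) set \<Rightarrow> bool" where
  "self_adjoint \<AA> \<longleftrightarrow> (\<forall>A\<in>\<AA>. cadjoint A \<in> \<AA>)"


section \<open>Single vertex 2-graphs\<close>

datatype gen = Egen nat | Fgen nat

definition two_graph :: "nat \<Rightarrow> nat \<Rightarrow> (nat \<times> nat \<Rightarrow> nat \<times> nat) \<Rightarrow> bool" where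
  "two_graph m n \<theta> \<longleftrightarrow>
     m > 0 \<and> n > 0 \<and> (m > 1 \<or> n > 1) \<and> \<theta> permutes ({1..m} \<times> {1..n})"

definition gens :: "nat \<Rightarrow> nat \<Rightarrow> gen set" where
  "gens m n = Egen ` {1..m} \<union> Fgen ` {1..n}"

inductive swap_step :: "nat \<Rightarrow> nat \<Rightarrow> (nat \<times> nat \<Rightarrow> nat \<times> nat) \<Rightarrow> gen list \<Rightarrow> gen list \<Rightarrow> bool"
  for m n \<theta> where
  "\<lbrakk>i \<in> {1..m}; j \<in> {1..n}; \<theta> (i, j) = (i', j')\<rbrakk>
     \<Longrightarrow> swap_step m n \<theta> (x @ [Egen i, Fgen j] @ y) (x @ [Fgen j', Egen i'] @ y)"

text \<open>Elements of the semigroup are classes of words modulo the congruence generated by the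
  relations \<open>e\<^sub>i f\<^sub>j = f\<^sub>j\<^sub>' e\<^sub>i\<^sub>'\<close>.\<close>

definition wclass :: "nat \<Rightarrow> nat \<Rightarrow> (nat \<times> nat \<Rightarrow> nat \<times> nat) \<Rightarrow> gen list \<Rightarrow> gen list set" where
  "wclass m n \<theta> x = {y. equivclp (swap_step m n \<theta>) x y}"

definition F_theta :: "nat \<Rightarrow> nat \<Rightarrow> (nat \<times> nat \<Rightarrow> nat \<times> nat) \<Rightarrow> gen list set monoid" where
  "F_theta m n \<theta> =
     \<lparr>carrier = wclass m n \<theta> ` lists (gens m n),
      mult = (\<lambda>a b. \<Union>x\<in>a. \<Union>y\<in>b. wclass m n \<theta> (x @ y)),
      one = wclass m n \<theta> []\<rparr>"

text \<open>\<open>e\<^sub>u f\<^sub>v\<close> for words \<open>u\<close> and \<open>v\<close> in the indices.\<close>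

definition ef :: "nat list \<Rightarrow> nat list \<Rightarrow> gen list" where
  "ef u v = map Egen u @ map Fgen v"

primrec is_E :: "gen \<Rightarrow> bool" where
  "is_E (Egen i) = True"
| "is_E (Fgen j) = False"

definition word_degree :: "gen list \<Rightarrow> nat \<times> nat" where
  "word_degree x = (length (filter is_E x), length (filter (\<lambda>a. \<not> is_E a) x))"

text \<open>All words in a class have the same degree, and the class of \<open>e\<^sub>u f\<^sub>v\<close> has degree
  \<open>(|u|, |v|)\<close>; see \<open>wdegree_ef\<close> below.\<close>

definition wdegree :: "gen list set \<Rightarrow> nat \<times> nat" where
  "wdegree w = the_elem (word_degree ` w)"


section \<open>Isometric representations and their algebras\<close>

definition isometric_representation ::
  "nat \<Rightarrow> nat \<Rightarrow> (nat \<times> nat \<Rightarrow> nat \<times> nat) \<Rightarrow>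
   (nat \<Rightarrow> 'a::complex_hilbert \<Rightarrow> 'a) \<Rightarrow> (nat \<Rightarrow> 'a \<Rightarrow> 'a) \<Rightarrow> bool" where
  "isometric_representation m n \<theta> S T \<longleftrightarrow>
     (\<forall>i\<in>{1..m}. S i \<in> bounded_ops) \<and> (\<forall>j\<in>{1..n}. T j \<in> bounded_ops) \<and>
     (\<forall>i\<in>{1..m}. \<forall>j\<in>{1..m}. cadjoint (S i) \<circ> S j = (if i = j then id else (\<lambda>x. 0))) \<and>
     (\<forall>k\<in>{1..n}. \<forall>l\<in>{1..n}. cadjoint (T k) \<circ> T l = (if k = l then id else (\<lambda>x. 0))) \<and>
     (\<forall>i\<in>{1..m}. \<forall>j\<in>{1..n}. \<forall>i' j'. \<theta> (i, j) = (i', j') \<longrightarrow> S i \<circ> T j = T j' \<circ> S i')"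

primrec gen_op :: "(nat \<Rightarrow> 'a \<Rightarrow> 'a) \<Rightarrow> (nat \<Rightarrow> 'a \<Rightarrow> 'a) \<Rightarrow> gen \<Rightarrow> 'a \<Rightarrow> 'a" where
  "gen_op S T (Egen i) = S i"
| "gen_op S T (Fgen j) = T j"

definition word_op :: "(nat \<Rightarrow> 'a \<Rightarrow> 'a) \<Rightarrow> (nat \<Rightarrow> 'a \<Rightarrow> 'a) \<Rightarrow> gen list \<Rightarrow> 'a \<Rightarrow> 'a" where
  "word_op S T x = foldr (\<lambda>a A. gen_op S T a \<circ> A) x id"

text \<open>The operator \<open>(ST)\<^sub>w\<close>. For an isometric representation all words in a class give the same
  operator, and the class of \<open>e\<^sub>u f\<^sub>v\<close> gives \<open>S\<^sub>u T\<^sub>v\<close>; see \<open>rep_op_ef\<close> below.\<close>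

definition rep_op :: "(nat \<Rightarrow> 'a \<Rightarrow> 'a) \<Rightarrow> (nat \<Rightarrow> 'a \<Rightarrow> 'a) \<Rightarrow> gen list set \<Rightarrow> 'a \<Rightarrow> 'a" where
  "rep_op S T w = the_elem (word_op S T ` w)"

definition two_graph_algebra ::
  "nat \<Rightarrow> nat \<Rightarrow> (nat \<Rightarrow> 'a::complex_hilbert \<Rightarrow> 'a) \<Rightarrow> (nat \<Rightarrow> 'a \<Rightarrow> 'a) \<Rightarrow> ('a \<Rightarrow> 'a) set" where
  "two_graph_algebra m n S T = unital_wot_closed_algebra hull (S ` {1..m} \<union> T ` {1..n})"

definition degree_algebra ::
  "nat \<Rightarrow> nat \<Rightarrow> (nat \<times> nat \<Rightarrow> nat \<times> nat) \<Rightarrow>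
   (nat \<Rightarrow> 'a::complex_hilbert \<Rightarrow> 'a) \<Rightarrow> (nat \<Rightarrow> 'a \<Rightarrow> 'a) \<Rightarrow> nat \<Rightarrow> nat \<Rightarrow> ('a \<Rightarrow> 'a) set" where
  "degree_algebra m n \<theta> S T k l =
     unital_wot_closed_algebra hull {rep_op S T w | w. w \<in> carrier (F_theta m n \<theta>) \<and> wdegree w = (k, l)}"


section \<open>The class-level notions are well defined\<close>

lemma wclass_self: "x \<in> wclass m n \<theta> x"
  by (simp add: wclass_def)

lemma the_elem_wclass:
  assumes "\<And>y. equivclp (swap_step m n \<theta>) x y \<Longrightarrow> f x = f y"
  shows "the_elem (f ` wclass m n \<theta> x) = f x"
proof -
  have "f y = f x" if "y \<in> wclass m n \<theta> x" for y
    using assms[of y] that by (simp add: wclass_def)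
  then have "f ` wclass m n \<theta> x = {f x}"
    using wclass_self[of x m n \<theta>] by blast
  then show ?thesis by simp
qed

lemma wclass_eq_iff: "wclass m n \<theta> x = wclass m n \<theta> y \<longleftrightarrow> equivclp (swap_step m n \<theta>) x y"
proof
  assume "wclass m n \<theta> x = wclass m n \<theta> y"
  then have "y \<in> wclass m n \<theta> x"
    by (simp add: wclass_def)
  then show "equivclp (swap_step m n \<theta>) x y"
    by (simp add: wclass_def)
next
  assume "equivclp (swap_step m n \<theta>) x y"
  then show "wclass m n \<theta> x = wclass m n \<theta> y"
    unfolding wclass_def by (blast intro: equivclp_trans equivclp_sym)
qed

lemma swap_step_context:
  assumes "swap_step m n \<theta> x y"
  shows "swap_step m n \<theta> (a @ x @ b) (a @ y @ b)"
  using assms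
proof cases
  case (1 i j i' j' p q)
  then show ?thesis
    using swap_step.intros[OF 1(3) 1(4), where \<theta> = \<theta> and i' = i' and j' = j' and x = "a @ p" and y = "q @ b"]
    by (simp only: append_assoc)
qed

lemma swap_equiv_context:
  assumes "equivclp (swap_step m n \<theta>) x y"
  shows "equivclp (swap_step m n \<theta>) (a @ x @ b) (a @ y @ b)"
  using assms
proof (induction rule: equivclp_induct)
  case (step y z)
  then have "equivclp (swap_step m n \<theta>) (a @ y @ b) (a @ z @ b)"
    by (meson r_into_equivclp equivclp_sym swap_step_context)
  with step show ?case by (meson equivclp_trans)
qed simp

lemma swap_equiv_append:
  assumes "equivclp (swap_step m n \<theta>) x x'" "equivclp (swap_step m n \<theta>) y y'"
  shows "equivclp (swap_step m n \<theta>) (x @ y) (x' @ y')"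
  using swap_equiv_context[OF assms(1), of "[]" y] swap_equiv_context[OF assms(2), of x' "[]"]
  by (auto intro: equivclp_trans)

lemma F_theta_mult:
  "mult (F_theta m n \<theta>) (wclass m n \<theta> x) (wclass m n \<theta> y) = wclass m n \<theta> (x @ y)"
proof -
  have "wclass m n \<theta> (x' @ y') = wclass m n \<theta> (x @ y)"
    if "x' \<in> wclass m n \<theta> x" "y' \<in> wclass m n \<theta> y" for x' y'
    unfolding wclass_eq_iff
    by (rule swap_equiv_append[THEN equivclp_sym]) (use that in \<open>simp_all add: wclass_def\<close>)
  then have "(\<Union>x'\<in>wclass m n \<theta> x. \<Union>y'\<in>wclass m n \<theta> y. wclass m n \<theta> (x' @ y'))
    = (\<Union>x'\<in>wclass m n \<theta> x. \<Union>y'\<in>wclass m n \<theta> y. wclass m n \<theta> (x @ y))"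
    by (intro SUP_cong refl)
  also have "\<dots> = wclass m n \<theta> (x @ y)"
    using wclass_self[of x m n \<theta>] wclass_self[of y m n \<theta>] by blast
  finally show ?thesis
    by (simp only: F_theta_def monoid.simps)
qed

lemma monoid_F_theta: "monoid (F_theta m n \<theta>)"
proof -
  have c: "carrier (F_theta m n \<theta>) = wclass m n \<theta> ` lists (gens m n)"
    and o: "one (F_theta m n \<theta>) = wclass m n \<theta> []"
    by (simp_all add: F_theta_def)
  show ?thesis
  proof (rule monoidI)
    fix a b
    assume "a \<in> carrier (F_theta m n \<theta>)" "b \<in> carrier (F_theta m n \<theta>)"
    then obtain x y where "x \<in> lists (gens m n)" "a = wclass m n \<theta> x"
      "y \<in> lists (gens m n)" "b = wclass m n \<theta> y"
      unfolding c by blast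
    then show "mult (F_theta m n \<theta>) a b \<in> carrier (F_theta m n \<theta>)"
      unfolding c by (metis F_theta_mult append_in_lists_conv imageI)
  qed (auto simp: c o F_theta_mult)
qed

lemma swap_equiv_degree:
  assumes "equivclp (swap_step m n \<theta>) x y"
  shows "word_degree x = word_degree y"
  using assms
  by (induction rule: equivclp_induct) (auto simp: word_degree_def elim!: swap_step.cases)

lemma word_op_append: "word_op S T (x @ y) = word_op S T x \<circ> word_op S T y"
  by (induction x) (auto simp: word_op_def fun_eq_iff)

lemma swap_equiv_op:
  assumes rep: "isometric_representation m n \<theta> S T"
    and "equivclp (swap_step m n \<theta>) x y"
  shows "word_op S T x = word_op S T y"
proof -
  have *: "word_op S T y = word_op S T z" if "swap_step m n \<theta> y z" for y z
    using that
  proof cases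
    case (1 i j i' j' p q)
    have "S i \<circ> T j = T j' \<circ> S i'"
      using rep 1 unfolding isometric_representation_def by blast
    then have "word_op S T [Egen i, Fgen j] = word_op S T [Fgen j', Egen i']"
      by (simp add: word_op_def)
    with 1 show ?thesis by (simp only: word_op_append)
  qed
  show ?thesis
    using assms(2) by (induction rule: equivclp_induct) (auto dest: *)
qed

lemma wdegree_wclass: "wdegree (wclass m n \<theta> x) = word_degree x"
  unfolding wdegree_def by (rule the_elem_wclass) (rule swap_equiv_degree)

lemma wdegree_ef: "wdegree (wclass m n \<theta> (ef u v)) = (length u, length v)"
proof -
  have "filter is_E (map Egen u) = map Egen u" "filter is_E (map Fgen v) = []"
    "filter (\<lambda>a. \<not> is_E a) (map Egen u) = []" "filter (\<lambda>a. \<not> is_E a) (map Fgen v) = map Fgen v"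
    by (induction u; simp) (induction v; simp)+
  then show ?thesis by (simp add: wdegree_wclass word_degree_def ef_def)
qed

lemma rep_op_wclass:
  assumes "isometric_representation m n \<theta> S T"
  shows "rep_op S T (wclass m n \<theta> x) = word_op S T x"
  unfolding rep_op_def by (rule the_elem_wclass) (rule swap_equiv_op[OF assms])

lemma rep_op_ef:
  assumes "isometric_representation m n \<theta> S T"
  shows "rep_op S T (wclass m n \<theta> (ef u v))
    = foldr (\<lambda>i A. S i \<circ> A) u id \<circ> foldr (\<lambda>j A. T j \<circ> A) v id"
proof -
  have "word_op S T (map Egen u) = foldr (\<lambda>i A. S i \<circ> A) u id"
    by (induction u) (auto simp: word_op_def)
  moreover have "word_op S T (map Fgen v) = foldr (\<lambda>j A. T j \<circ> A) v id"
    by (induction v) (auto simp: word_op_def)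
  ultimately show ?thesis
    by (simp add: rep_op_wclass[OF assms] ef_def word_op_append)
qed

end

theory Submission
  imports Defs
begin

text \<open>
  If \<open>w = w' g\<close> has degree \<open>(k, l)\<close> and ends in the generator \<open>g\<close>, then
  \<open>(ST)\<^sub>w\<^sup>* (ST)\<^sub>w\<^sub>' = (ST)\<^sub>g\<^sup>*\<close>, because \<open>(ST)\<^sub>w\<^sub>'\<close> is an isometry. When \<open>\<SS>\<^sub>k\<^sub>,\<^sub>l\<close> is
  self-adjoint, the left-hand side lies in \<open>\<SS>\<close>, and since \<open>k, l > 0\<close> every generator
  occurs as some \<open>g\<close>. So \<open>\<SS>\<close> contains the adjoints of its generators; the adjoint being
  conjugate linear, antimultiplicative and WOT-continuous, \<open>\<SS>\<close> is self-adjoint.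
\<close>

section \<open>The inner product\<close>

lemma cinner_add_right: "cinner x (y + z) = cinner x y + cinner x (z::'a::complex_hilbert)"
  by (metis cinner_add_left cinner_commute complex_cnj_add)

lemma cinner_scaleC_right: "cinner x (c *\<^sub>C y) = cnj c * cinner x (y::'a::complex_hilbert)"
  by (metis cinner_scaleC_left cinner_commute complex_cnj_mult)

lemma cinner_scaleR_left: "cinner (r *\<^sub>R x) y = of_real r * cinner x (y::'a::complex_hilbert)"
  by (simp add: scaleR_scaleC cinner_scaleC_left)

lemma cinner_diff_right: "cinner x (y - z) = cinner x y - cinner x (z::'a::complex_hilbert)"
  by (metis cinner_add_right add_diff_cancel diff_add_cancel)

lemma cinner_extensionality:
  assumes "\<And>x. cinner x y = cinner x (z::'a::complex_hilbert)"
  shows "y = z"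
proof -
  have "cinner (y - z) (y - z) = 0"
    by (simp add: cinner_diff_right assms)
  then show ?thesis
    by (simp add: cinner_eq_zero_iff)
qed

lemma power2_norm_eq_cinner: "(norm x)\<^sup>2 = Re (cinner x (x::'a::complex_hilbert))"
  by (simp add: norm_eq_sqrt_cinner cinner_self_ge_zero)

lemma Re_cinner_commute: "Re (cinner x y) = Re (cinner y (x::'a::complex_hilbert))"
  by (subst cinner_commute) simp

lemma power2_norm_add:
  "(norm (x + y))\<^sup>2 = (norm x)\<^sup>2 + 2 * Re (cinner x y) + (norm (y::'a::complex_hilbert))\<^sup>2"
  using Re_cinner_commute[of x y]
  by (simp add: power2_norm_eq_cinner cinner_add_left cinner_add_right)

lemma norm_scaleC: "norm (c *\<^sub>C x) = cmod c * norm (x::'a::complex_hilbert)"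
proof -
  have "cinner (c *\<^sub>C x) (c *\<^sub>C x) = of_real ((cmod c)\<^sup>2) * cinner x x"
    by (simp add: cinner_scaleC_left cinner_scaleC_right complex_norm_square mult.assoc[symmetric]
        del: of_real_power)
  then show ?thesis
    by (simp add: norm_eq_sqrt_cinner real_sqrt_mult)
qed

text \<open>The triangle inequality comes with the class, so squaring it and expanding both sides
  already yields the real part of Cauchy-Schwarz.\<close>

lemma Re_cinner_le: "Re (cinner x y) \<le> norm x * norm (y::'a::complex_hilbert)"
proof -
  have "(norm (x + y))\<^sup>2 \<le> (norm x + norm y)\<^sup>2"
    by (intro power_mono norm_triangle_ineq norm_ge_zero)
  then show ?thesis
    by (simp add: power2_norm_add power2_sum)
qed

lemma norm_cinner_le: "cmod (cinner x y) \<le> norm x * norm (y::'a::complex_hilbert)"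
proof (cases "cinner x y = 0")
  case False
  \<comment> \<open>A phase that rotates \<open>cinner x y\<close> onto the positive real axis, so
    that the bound on real parts, applied to \<open>c *\<^sub>C x\<close>, bounds the
    modulus.\<close>
  define c where "c = cnj (sgn (cinner x y))"
  have "c * cinner x y = of_real (cmod (cinner x y))"
    using False
    by (simp add: c_def sgn_div_norm scaleR_conv_of_real mult.assoc
        complex_norm_square[unfolded mult.commute[of _ "cnj _"], symmetric] power2_eq_square)
  moreover have "cmod c = 1"
    using False by (simp add: c_def norm_sgn)
  ultimately show ?thesis
    using Re_cinner_le[of "c *\<^sub>C x" y] by (simp add: cinner_scaleC_left norm_scaleC)
qed simp

section \<open>The Riesz representation theorem and adjoints\<close>

text \<open>The representing vector is the minimizer of \<open>x \<mapsto> \<parallel>x\<parallel>\<^sup>2 - 2 Re (f x)\<close>.\<close>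

lemma riesz_representation:
  fixes f :: "'a::complex_hilbert \<Rightarrow> complex"
  assumes "bounded_linear f" and scaleC: "\<And>c x. f (c *\<^sub>C x) = c * f x"
  obtains z where "\<And>x. f x = cinner x z"
proof -
  interpret bounded_linear f by fact
  define \<phi> where "\<phi> x = (norm x)\<^sup>2 - 2 * Re (f x)" for x
  define I where "I = Inf (range \<phi>)"
  obtain K where K: "\<And>x. norm (f x) \<le> norm x * K"
    using bounded by blast
  have "- K\<^sup>2 \<le> \<phi> x" for x
  proof -
    have "Re (f x) \<le> norm x * K"
      using K[of x] complex_Re_le_cmod[of "f x"] by linarith
    moreover have "0 \<le> (norm x - K)\<^sup>2"
      by simp
    ultimately show ?thesis
      by (simp add: \<phi>_def power2_diff)
  qed
  then have bdd: "bdd_below (range \<phi>)"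
    by (intro bdd_belowI[of _ "- K\<^sup>2"]) auto
  have I_le: "I \<le> \<phi> x" for x
    unfolding I_def by (rule cInf_lower[OF _ bdd]) simp
  have "\<exists>x. \<phi> x < I + inverse (Suc n)" for n
    using cInf_lessD[of "range \<phi>" "I + inverse (Suc n)"] by (auto simp: I_def)
  then obtain X where X: "\<And>n. \<phi> (X n) < I + inverse (Suc n)"
    by metis
  \<comment> \<open>In the parallelogram law the \<open>f\<close> terms cancel, as the real part of
    \<open>f\<close> at the midpoint is the mean of the two real parts. The midpoint value is at
    least \<open>I\<close>, so near-minimizers are close to each other.\<close>
  have parallelogram: "(norm (x - y))\<^sup>2 = 2 * \<phi> x + 2 * \<phi> y - 4 * \<phi> ((1/2) *\<^sub>R (x + y))" for x y
  proof -
    have "(norm ((1/2) *\<^sub>R (x + y)))\<^sup>2 = (norm (x + y))\<^sup>2 / 4"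
      by (simp add: power_divide del: scaleR_right_distrib scaleR_add_right)
    moreover have "Re (f ((1/2) *\<^sub>R (x + y))) = (Re (f x) + Re (f y)) / 2"
      by (simp add: add scaleR del: scaleR_right_distrib scaleR_add_right)
    \<comment> \<open>The instance of \<open>cinner_diff_right\<close> at zero vectors supplies
      \<open>cinner x 0 = 0\<close>.\<close>
    moreover have "Re (cinner x (- y)) = - Re (cinner x y)"
      using cinner_add_right[of x y "- y"] cinner_diff_right[of x 0 0]
      by (simp add: complex_eq_iff)
    then have "(norm (x - y))\<^sup>2 = (norm x)\<^sup>2 - 2 * Re (cinner x y) + (norm y)\<^sup>2"
      using power2_norm_add[of x "- y"] by simp
    ultimately show ?thesis
      by (simp add: \<phi>_def power2_norm_add)
  qed
  have "Cauchy X"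
  proof (rule metric_CauchyI)
    fix e :: real
    assume e: "0 < e"
    \<comment> \<open>The choice of a quarter makes the bound exact:
      \<open>2 * (I + e^2/4) + 2 * (I + e^2/4) - 4 * I = e^2\<close>.\<close>
    then obtain N where N: "inverse (Suc N) < e\<^sup>2 / 4"
      using reals_Archimedean[of "e\<^sup>2 / 4"] by auto
    have "dist (X p) (X q) < e" if "p \<ge> N" "q \<ge> N" for p q
    proof -
      have "inverse (Suc r) \<le> inverse (Suc N)" if "r \<ge> N" for r
        using that by (simp add: le_imp_inverse_le)
      then have "\<phi> (X p) < I + e\<^sup>2 / 4" "\<phi> (X q) < I + e\<^sup>2 / 4"
        using that X[of p] X[of q] N by (smt (verit))+
      then have "(norm (X p - X q))\<^sup>2 < e\<^sup>2"
        using parallelogram[of "X p" "X q"] I_le[of "(1/2) *\<^sub>R (X p + X q)"] by linarith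
      then show ?thesis
        using e by (simp add: dist_norm power2_less_imp_less)
    qed
    then show "\<exists>N. \<forall>p\<ge>N. \<forall>q\<ge>N. dist (X p) (X q) < e"
      by blast
  qed
  \<comment> \<open>Completeness gives the limit; continuity of \<open>\<phi>\<close> makes it
    attain the infimum.\<close>
  then obtain z where z: "X \<longlonglongrightarrow> z"
    using Cauchy_convergent convergent_def by blast
  then have "(\<lambda>n. \<phi> (X n)) \<longlonglongrightarrow> \<phi> z"
    unfolding \<phi>_def by (intro tendsto_intros tendsto)
  moreover have "(\<lambda>n. I + inverse (Suc n)) \<longlonglongrightarrow> I + 0"
    by (intro tendsto_intros LIMSEQ_inverse_real_of_nat)
  ultimately have "\<phi> z \<le> I + 0"
    using X by (intro LIMSEQ_le) (auto intro: less_imp_le)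
  then have min: "\<phi> z \<le> \<phi> x" for x
    using I_le[of x] by simp
  have Re_eq: "Re (f h) = Re (cinner h z)" for h
  proof -
    \<comment> \<open>First variation at the minimizer: moving from \<open>z\<close> by
      \<open>t *\<^sub>R h\<close> changes \<open>\<phi>\<close> by
      \<open>2 * t * b + t^2 * |h|^2\<close>. The optimal \<open>t\<close> would be
      \<open>- b / |h|^2\<close>; the added 1 keeps the denominator positive when
      \<open>h = 0\<close> and still leaves a change of at most \<open>- b^2 / (|h|^2 + 1)\<close>,
      which forces \<open>b = 0\<close>.\<close>
    define b where "b = Re (cinner h z) - Re (f h)"
    define t where "t = - b / ((norm h)\<^sup>2 + 1)"
    have pos: "(norm h)\<^sup>2 + 1 > 0"
      by (simp add: add_nonneg_pos)
    have "\<phi> (t *\<^sub>R h + z) = \<phi> z + 2 * t * b + t\<^sup>2 * (norm h)\<^sup>2"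
      by (simp add: \<phi>_def b_def power2_norm_add add scaleR cinner_scaleR_left
          power_mult_distrib) (simp add: algebra_simps)
    then have "0 \<le> 2 * t * b + t\<^sup>2 * (norm h)\<^sup>2"
      using min[of "t *\<^sub>R h + z"] by simp
    also have "\<dots> \<le> 2 * t * b + t\<^sup>2 * ((norm h)\<^sup>2 + 1)"
      by (simp add: algebra_simps)
    also have "\<dots> = - b\<^sup>2 / ((norm h)\<^sup>2 + 1)"
    proof -
      have "t * ((norm h)\<^sup>2 + 1) = - b"
        using pos by (simp add: t_def)
      then have "t\<^sup>2 * ((norm h)\<^sup>2 + 1) = - (t * b)"
        by (simp add: power2_eq_square mult.assoc)
      then show ?thesis
        by (simp add: t_def power2_eq_square)
    qed
    finally have "b\<^sup>2 \<le> 0"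
      using pos by (auto simp: divide_le_0_iff)
    then show ?thesis
      by (simp add: b_def)
  qed
  \<comment> \<open>The imaginary part at \<open>x\<close> is minus the real part at
    \<open>\<i> *\<^sub>C x\<close>.\<close>
  have "f x = cinner x z" for x
    using Re_eq[of x] Re_eq[of "\<i> *\<^sub>C x"]
    by (simp add: scaleC cinner_scaleC_left complex_eq_iff)
  then show ?thesis
    by (rule that)
qed

section \<open>Existence, uniqueness and boundedness of adjoints\<close>

lemma bounded_ops_bounded_linear: "A \<in> bounded_ops \<Longrightarrow> bounded_linear A"
  and bounded_ops_scaleC: "A \<in> bounded_ops \<Longrightarrow> A (c *\<^sub>C x) = c *\<^sub>C A x"
  by (simp_all add: bounded_ops_def)

lemma bounded_opsI:
  assumes "\<And>x y. A (x + y) = A x + A y" "\<And>c x. A (c *\<^sub>C x) = c *\<^sub>C A x"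
    and "\<And>x. norm (A x) \<le> norm x * K"
  shows "A \<in> bounded_ops"
  unfolding bounded_ops_def using assms
  by (auto intro!: bounded_linear_intro[of A K] simp: scaleR_scaleC)

text \<open>Inner products separate vectors, so at most one map satisfies the adjoint identity;
  exhibiting one evaluates the definite description.\<close>

lemma cadjoint_eqI:
  assumes "\<And>x y. cinner (A x) y = cinner x (B y)"
  shows "cadjoint A = B"
  unfolding cadjoint_def
proof (rule the_equality)
  fix C
  assume "\<forall>x y. cinner (A x) y = cinner x (C y)"
  then have "cinner x (C y) = cinner x (B y)" for x y
    using assms by metis
  then show "C = B"
    using cinner_extensionality by blast
qed (use assms in blast)

text \<open>For each \<open>y\<close>, Riesz represents the bounded functional
  \<open>x \<mapsto> cinner (A x) y\<close> by a vector; choosing these vectors gives the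
  adjoint.\<close>

lemma cinner_cadjoint_right:
  assumes A: "A \<in> bounded_ops"
  shows "cinner x (cadjoint A y) = cinner (A x) y"
proof -
  interpret bounded_linear A
    using A by (rule bounded_ops_bounded_linear)
  obtain K where K: "\<And>x. norm (A x) \<le> norm x * K"
    using bounded by blast
  have "\<exists>z. \<forall>x. cinner (A x) y = cinner x z" for y
  proof -
    have "bounded_linear (\<lambda>x. cinner (A x) y)"
    proof (rule bounded_linear_intro[where K = "K * norm y"])
      show "norm (cinner (A x) y) \<le> norm x * (K * norm y)" for x
        using norm_cinner_le[of "A x" y] mult_right_mono[OF K[of x], of "norm y"]
        by (simp add: mult.assoc)
    qed (simp_all add: add scaleR cinner_add_left cinner_scaleR_left scaleR_conv_of_real)
    then obtain z where "\<And>x. cinner (A x) y = cinner x z"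
      by (rule riesz_representation)
        (simp_all add: A bounded_ops_scaleC cinner_scaleC_left)
    then show ?thesis
      by blast
  qed
  then obtain B where "\<And>x y. cinner (A x) y = cinner x (B y)"
    by metis
  then show ?thesis
    by (simp add: cadjoint_eqI)
qed

lemma cinner_cadjoint_left:
  assumes "A \<in> bounded_ops"
  shows "cinner (cadjoint A x) y = cinner x (A y)"
  by (metis assms cinner_cadjoint_right cinner_commute)

lemma cadjoint_in_bounded_ops:
  assumes A: "A \<in> bounded_ops"
  shows "cadjoint A \<in> bounded_ops"
proof -
  note adj = cinner_cadjoint_right[OF A]
  obtain K where K: "\<And>x. norm (A x) \<le> norm x * K"
    using bounded_linear.bounded[OF bounded_ops_bounded_linear[OF A]] by blast
  show ?thesis
  proof (rule bounded_opsI)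
    show "cadjoint A (x + y) = cadjoint A x + cadjoint A y" for x y
      by (rule cinner_extensionality) (simp add: adj cinner_add_right)
    show "cadjoint A (c *\<^sub>C x) = c *\<^sub>C cadjoint A x" for c x
      by (rule cinner_extensionality) (simp add: adj cinner_scaleC_right)
    \<comment> \<open>The bound for \<open>A\<close> carries over with the same \<open>K\<close>:
      estimate the square of the left-hand norm and cancel one factor, which requires that factor to
      be nonzero.\<close>
    show "norm (cadjoint A y) \<le> norm y * K" for y
    proof (cases "cadjoint A y = 0")
      case True
      have "0 \<le> norm y * K"
        using K[of y] norm_ge_zero order_trans by blast
      with True show ?thesis by simp
    next
      case False
      have "(norm (cadjoint A y))\<^sup>2 = Re (cinner (A (cadjoint A y)) y)"
        by (simp add: power2_norm_eq_cinner adj)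
      also have "\<dots> \<le> norm (A (cadjoint A y)) * norm y"
        by (rule Re_cinner_le)
      also have "\<dots> \<le> (norm (cadjoint A y) * K) * norm y"
        by (intro mult_right_mono K norm_ge_zero)
      finally show ?thesis
        using False by (simp add: power2_eq_square mult.assoc mult.commute[of K])
    qed
  qed
qed

section \<open>Algebraic operations on bounded operators and their adjoints\<close>

lemma id_in_bounded_ops: "id \<in> bounded_ops"
  by (rule bounded_opsI[where K = 1]) simp_all

lemma add_in_bounded_ops:
  "A \<in> bounded_ops \<Longrightarrow> B \<in> bounded_ops \<Longrightarrow> (\<lambda>x. A x + B x) \<in> bounded_ops"
  by (simp add: bounded_ops_def bounded_linear_add scaleC_add_right)

lemma comp_in_bounded_ops: "A \<in> bounded_ops \<Longrightarrow> B \<in> bounded_ops \<Longrightarrow> A \<circ> B \<in> bounded_ops"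
  by (simp add: bounded_ops_def comp_def bounded_linear_compose)

lemma scaleC_in_bounded_ops:
  assumes A: "A \<in> bounded_ops"
  shows "(\<lambda>x. c *\<^sub>C A x) \<in> bounded_ops"
proof -
  interpret bounded_linear A
    using A by (rule bounded_ops_bounded_linear)
  obtain K where K: "\<And>x. norm (A x) \<le> norm x * K"
    using bounded by blast
  show ?thesis
  proof (rule bounded_opsI)
    show "norm (c *\<^sub>C A x) \<le> norm x * (cmod c * K)" for x
      using mult_left_mono[OF K[of x], of "cmod c"] by (simp add: norm_scaleC mult_ac)
  qed (simp_all add: add scaleC_add_right bounded_ops_scaleC[OF A] scaleC_scaleC mult.commute)
qed

lemma cadjoint_id: "cadjoint id = id"
  by (rule cadjoint_eqI) simp

lemma cadjoint_add:
  "A \<in> bounded_ops \<Longrightarrow> B \<in> bounded_ops \<Longrightarrow>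
    cadjoint (\<lambda>x. A x + B x) = (\<lambda>x. cadjoint A x + cadjoint B x)"
  by (rule cadjoint_eqI) (simp add: cinner_cadjoint_right cinner_add_left cinner_add_right)

lemma cadjoint_scaleC:
  "A \<in> bounded_ops \<Longrightarrow> cadjoint (\<lambda>x. c *\<^sub>C A x) = (\<lambda>x. cnj c *\<^sub>C cadjoint A x)"
  by (rule cadjoint_eqI) (simp add: cinner_cadjoint_right cinner_scaleC_left cinner_scaleC_right)

lemma cadjoint_comp:
  "A \<in> bounded_ops \<Longrightarrow> B \<in> bounded_ops \<Longrightarrow> cadjoint (A \<circ> B) = cadjoint B \<circ> cadjoint A"
  by (rule cadjoint_eqI) (simp add: cinner_cadjoint_right)

section \<open>WOT-closed algebras\<close>

lemma topspace_wot: "topspace wot = bounded_ops"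
proof -
  \<comment> \<open>With \<open>U = UNIV\<close> a subbasic set is already the whole of
    \<open>bounded_ops\<close>.\<close>
  have "bounded_ops \<in> {{A \<in> bounded_ops. cinner (A x) y \<in> U} | x y U. open U}"
    by (rule CollectI, intro exI[of _ 0] exI[of _ UNIV]) simp
  then show ?thesis
    unfolding wot_def topology_generated_by_topspace by blast
qed

lemma openin_wot_coefficient: "open U \<Longrightarrow> openin wot {A \<in> bounded_ops. cinner (A x) y \<in> U}"
  unfolding wot_def by (rule topology_generated_by_Basis) blast

text \<open>Taking adjoints swaps the two vectors of a matrix coefficient and conjugates its value,
  so the preimage of a subbasic open set is again subbasic.\<close>

lemma continuous_map_wot_cadjoint: "continuous_map wot wot cadjoint"
proof -
  have "openin wot (cadjoint -` {A \<in> bounded_ops. cinner (A x) y \<in> U} \<inter> topspace wot)"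
    if U: "open U" for x y :: 'a and U
  proof -
    have "cadjoint -` {A \<in> bounded_ops. cinner (A x) y \<in> U} \<inter> topspace wot
        = {A \<in> bounded_ops. cinner (A y) x \<in> cnj -` U}"
      by (auto simp: topspace_wot cadjoint_in_bounded_ops cinner_cadjoint_left
          cinner_commute[of _ x])
    moreover have "open (cnj -` U)"
      using U by (intro open_vimage continuous_intros)
    ultimately show ?thesis
      by (simp only: openin_wot_coefficient)
  qed
  moreover have "cadjoint ` topspace wot
      \<subseteq> \<Union> {{A \<in> bounded_ops. cinner (A x) y \<in> U} | x y U. open U}"
    unfolding topology_generated_by_topspace[symmetric] wot_def[symmetric]
    by (auto simp: topspace_wot cadjoint_in_bounded_ops)
  ultimately show ?thesis
    by (subst (2) wot_def, intro continuous_on_generated_topo) auto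
qed

lemma
  assumes "unital_wot_closed_algebra \<AA>"
  shows wot_closed_algebra_bounded: "A \<in> \<AA> \<Longrightarrow> A \<in> bounded_ops"
    and wot_closed_algebra_id: "id \<in> \<AA>"
    and wot_closed_algebra_add: "A \<in> \<AA> \<Longrightarrow> B \<in> \<AA> \<Longrightarrow> (\<lambda>x. A x + B x) \<in> \<AA>"
    and wot_closed_algebra_scaleC: "A \<in> \<AA> \<Longrightarrow> (\<lambda>x. c *\<^sub>C A x) \<in> \<AA>"
    and wot_closed_algebra_comp: "A \<in> \<AA> \<Longrightarrow> B \<in> \<AA> \<Longrightarrow> A \<circ> B \<in> \<AA>"
    and wot_closed_algebra_closedin: "closedin wot \<AA>"
  using assms unfolding unital_wot_closed_algebra_def by blast+

text \<open>Ensures that the family intersected in the hull of a set of bounded operators is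
  nonempty.\<close>

lemma unital_wot_closed_algebra_bounded_ops: "unital_wot_closed_algebra bounded_ops"
  unfolding unital_wot_closed_algebra_def
  using closedin_topspace[of wot]
  by (simp add: topspace_wot id_in_bounded_ops add_in_bounded_ops scaleC_in_bounded_ops
      comp_in_bounded_ops)

lemma unital_wot_closed_algebra_Inter:
  assumes "\<F> \<noteq> {}" "\<And>\<AA>. \<AA> \<in> \<F> \<Longrightarrow> unital_wot_closed_algebra \<AA>"
  shows "unital_wot_closed_algebra (\<Inter>\<F>)"
proof -
  have "\<Inter>\<F> \<subseteq> bounded_ops"
    using assms by (meson Inter_lower ex_in_conv order_trans unital_wot_closed_algebra_def)
  moreover have "closedin wot (\<Inter>\<F>)"
    using assms by (intro closedin_Inter) (auto simp: unital_wot_closed_algebra_def)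
  ultimately show ?thesis
    using assms(2) by (simp add: unital_wot_closed_algebra_def)
qed

text \<open>The hypothesis rules out the junk value \<open>UNIV\<close> of the hull.\<close>

lemma unital_wot_closed_algebra_hull:
  assumes "G \<subseteq> bounded_ops"
  shows "unital_wot_closed_algebra (unital_wot_closed_algebra hull G)"
  unfolding hull_def
  by (rule unital_wot_closed_algebra_Inter)
    (use assms unital_wot_closed_algebra_bounded_ops in auto)

text \<open>The members of the hull whose adjoint also lies in the hull form a unital WOT-closed
  algebra containing \<open>G\<close>, so by minimality they are the whole hull. WOT-closedness of
  this set rests on continuity of the adjoint.\<close>

lemma self_adjoint_hull:
  assumes G: "G \<subseteq> bounded_ops"
    and adj: "\<And>A. A \<in> G \<Longrightarrow> cadjoint A \<in> unital_wot_closed_algebra hull G"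
  shows "self_adjoint (unital_wot_closed_algebra hull G)"
proof -
  let ?H = "unital_wot_closed_algebra hull G"
  define \<BB> where "\<BB> = {A \<in> ?H. cadjoint A \<in> ?H}"
  have H: "unital_wot_closed_algebra ?H"
    using G by (rule unital_wot_closed_algebra_hull)
  note bdd = wot_closed_algebra_bounded[OF H]
  have "{A \<in> topspace wot. cadjoint A \<in> ?H} \<inter> ?H = \<BB>"
    by (auto simp: \<BB>_def topspace_wot bdd)
  moreover have "closedin wot ({A \<in> topspace wot. cadjoint A \<in> ?H} \<inter> ?H)"
    using wot_closed_algebra_closedin[OF H]
    by (intro closedin_Int closedin_continuous_map_preimage[OF continuous_map_wot_cadjoint])
  ultimately have "closedin wot \<BB>"
    by simp
  moreover have "\<BB> \<subseteq> bounded_ops"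
    using bdd by (auto simp: \<BB>_def)
  moreover have "id \<in> \<BB>"
    using wot_closed_algebra_id[OF H] by (simp only: \<BB>_def mem_Collect_eq cadjoint_id)
  moreover have "(\<lambda>x. A x + B x) \<in> \<BB>" "A \<circ> B \<in> \<BB>" if "A \<in> \<BB>" "B \<in> \<BB>" for A B
    using that wot_closed_algebra_add[OF H] wot_closed_algebra_comp[OF H]
    by (simp_all only: \<BB>_def mem_Collect_eq bdd cadjoint_add cadjoint_comp)
  moreover have "(\<lambda>x. c *\<^sub>C A x) \<in> \<BB>" if "A \<in> \<BB>" for c A
    using that wot_closed_algebra_scaleC[OF H]
    by (simp only: \<BB>_def mem_Collect_eq bdd cadjoint_scaleC)
  ultimately have "unital_wot_closed_algebra \<BB>"
    unfolding unital_wot_closed_algebra_def by blast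
  moreover have "G \<subseteq> \<BB>"
    using adj by (auto simp: \<BB>_def hull_inc)
  ultimately have "?H \<subseteq> \<BB>"
    by (rule hull_minimal[rotated])
  then show ?thesis
    by (auto simp: self_adjoint_def \<BB>_def)
qed

section \<open>Isometric representations\<close>

lemma gen_op_in_bounded_ops:
  assumes "isometric_representation m n \<theta> S T" "g \<in> gens m n"
  shows "gen_op S T g \<in> bounded_ops"
  using assms by (auto simp: isometric_representation_def gens_def)

lemma gen_op_isometric:
  assumes rep: "isometric_representation m n \<theta> S T" and g: "g \<in> gens m n"
  shows "cinner (gen_op S T g x) (gen_op S T g y) = cinner x y"
proof -
  have "cadjoint (gen_op S T g) \<circ> gen_op S T g = id"
    using assms by (auto simp: isometric_representation_def gens_def)
  then show ?thesis
    using cinner_cadjoint_right[OF gen_op_in_bounded_ops[OF assms], of x "gen_op S T g y"]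
    by (simp add: pointfree_idE)
qed

lemma word_op_Nil: "word_op S T [] = id"
  by (simp add: word_op_def fun_eq_iff)

lemma word_op_Cons: "word_op S T (g # x) = gen_op S T g \<circ> word_op S T x"
  by (simp add: word_op_def)

lemma word_op_isometric:
  assumes "isometric_representation m n \<theta> S T" "w \<in> lists (gens m n)"
  shows "cinner (word_op S T w x) (word_op S T w y) = cinner x y"
  using assms(2)
  by (induction w) (simp_all add: word_op_Nil word_op_Cons gen_op_isometric[OF assms(1)])

lemma word_op_in_algebra:
  assumes "unital_wot_closed_algebra \<AA>" "\<And>g. g \<in> set w \<Longrightarrow> gen_op S T g \<in> \<AA>"
  shows "word_op S T w \<in> \<AA>"
  using assms(2)
proof (induction w)
  case Nil
  show ?case
    unfolding word_op_Nil by (rule wot_closed_algebra_id) fact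
next
  case (Cons g w)
  then show ?case
    unfolding word_op_Cons by (intro wot_closed_algebra_comp[OF assms(1)]) simp_all
qed

text \<open>This is \<open>(W A)* W = A* W* W = A*\<close>. It serves to extract the adjoint of the
  last letter \<open>A\<close> of a word from the adjoint of the whole word.\<close>

lemma cadjoint_comp_isometric:
  assumes W: "W \<in> bounded_ops" "\<And>x y. cinner (W x) (W y) = cinner x y" and A: "A \<in> bounded_ops"
  shows "cadjoint (W \<circ> A) \<circ> W = cadjoint A"
proof (rule ext, rule cinner_extensionality)
  show "cinner x ((cadjoint (W \<circ> A) \<circ> W) y) = cinner x (cadjoint A y)" for x y
    using cinner_cadjoint_right[OF comp_in_bounded_ops[OF W(1) A], of x "W y"]
    by (simp add: W(2) cinner_cadjoint_right[OF A])
qed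

text \<open>Merges the two families of generators into one, so that later arguments treat
  \<open>S\<close> and \<open>T\<close> uniformly.\<close>

lemma two_graph_algebra_gens:
  "two_graph_algebra m n S T = unital_wot_closed_algebra hull (gen_op S T ` gens m n)"
  by (simp add: two_graph_algebra_def gens_def image_Un image_image)

theorem corollary5p6:
  fixes m n :: nat
    and \<theta> :: "nat \<times> nat \<Rightarrow> nat \<times> nat"
    and S T :: "nat \<Rightarrow> 'a::complex_hilbert \<Rightarrow> 'a"
  assumes "two_graph m n \<theta>"
    and "isometric_representation m n \<theta> S T"
    and "\<exists>k>0. \<exists>l>0. self_adjoint (degree_algebra m n \<theta> S T k l)"
  shows "self_adjoint (two_graph_algebra m n S T)"
proof -
  let ?G = "gen_op S T ` gens m n"
  define H where "H = two_graph_algebra m n S T"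
  obtain k l where kl: "k > 0" "l > 0" and sa: "self_adjoint (degree_algebra m n \<theta> S T k l)"
    using assms(3) by blast
  have G: "?G \<subseteq> bounded_ops"
    using gen_op_in_bounded_ops[OF assms(2)] by blast
  then have H: "unital_wot_closed_algebra H"
    by (simp add: H_def two_graph_algebra_gens unital_wot_closed_algebra_hull)
  have word_H: "word_op S T w \<in> H" if "w \<in> lists (gens m n)" for w
    using that by (intro word_op_in_algebra[OF H])
      (auto simp: H_def two_graph_algebra_gens intro!: hull_inc)
  let ?W = "{rep_op S T w | w. w \<in> carrier (F_theta m n \<theta>) \<and> wdegree w = (k, l)}"
  have carrier: "carrier (F_theta m n \<theta>) = wclass m n \<theta> ` lists (gens m n)"
    by (simp add: F_theta_def)
  \<comment> \<open>Each operator of degree \<open>(k, l)\<close> is a product of generators, so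
    minimality of the hull puts the degree algebra inside \<open>H\<close>.\<close>
  have "?W \<subseteq> H"
    by (auto simp: carrier rep_op_wclass[OF assms(2)] intro!: word_H)
  then have sub: "degree_algebra m n \<theta> S T k l \<subseteq> H"
    unfolding degree_algebra_def using H by (rule hull_minimal)
  have adj_word: "cadjoint (word_op S T w) \<in> H"
    if w: "w \<in> lists (gens m n)" and d: "word_degree w = (k, l)" for w
  proof -
    have "rep_op S T (wclass m n \<theta> w) \<in> degree_algebra m n \<theta> S T k l"
      unfolding degree_algebra_def
      by (rule hull_inc) (use w d in \<open>auto simp: carrier wdegree_wclass\<close>)
    then show ?thesis
      using sa sub by (auto simp: self_adjoint_def rep_op_wclass[OF assms(2)])
  qed
  have adj_gen: "cadjoint (gen_op S T g) \<in> H"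
    if w: "w \<in> lists (gens m n)" and g: "g \<in> gens m n" and d: "word_degree (w @ [g]) = (k, l)"
    for w g
  proof -
    have "word_op S T (w @ [g]) = word_op S T w \<circ> gen_op S T g"
      by (simp add: word_op_append) (simp add: word_op_def)
    \<comment> \<open>The first factor lies in \<open>H\<close> by self-adjointness of the degree
      algebra. The prefix \<open>w\<close> has smaller degree, but as a product of generators it
      lies in \<open>H\<close> too.\<close>
    then have "cadjoint (gen_op S T g) = cadjoint (word_op S T (w @ [g])) \<circ> word_op S T w"
      using wot_closed_algebra_bounded[OF H word_H[OF w]] gen_op_in_bounded_ops[OF assms(2) g]
        word_op_isometric[OF assms(2) w]
      by (simp only: cadjoint_comp_isometric)
    also have "\<dots> \<in> H"
      using adj_word[OF _ d] word_H[OF w] w g by (intro wot_closed_algebra_comp[OF H]) simp_all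
    finally show ?thesis .
  qed
  \<comment> \<open>Positivity of \<open>m\<close> and \<open>n\<close> provides a letter of each
    kind to pad words with.\<close>
  have mn: "Egen 1 \<in> gens m n" "Fgen 1 \<in> gens m n"
    using assms(1) by (auto simp: two_graph_def gens_def)
  have "cadjoint (gen_op S T g) \<in> H" if g: "g \<in> gens m n" for g
  proof (cases g)
    case (Egen i)
    show ?thesis
      \<comment> \<open>The final letter \<open>g\<close> supplies the missing \<open>Egen\<close>,
        which uses \<open>k > 0\<close>. The full word is not in the form \<open>ef u v\<close> when
        \<open>l > 0\<close>, but degree only counts letters and \<open>adj_gen\<close> accepts any
        word.\<close>
      by (rule adj_gen[OF _ g, of "replicate (k - 1) (Egen 1) @ replicate l (Fgen 1)"])
        (use kl mn Egen in \<open>auto simp: word_degree_def\<close>)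
  next
    case (Fgen j)
    show ?thesis
      by (rule adj_gen[OF _ g, of "replicate k (Egen 1) @ replicate (l - 1) (Fgen 1)"])
        (use kl mn Fgen in \<open>auto simp: word_degree_def\<close>)
  qed
  then show ?thesis
    unfolding two_graph_algebra_gens H_def using G by (intro self_adjoint_hull) auto
qed

end
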